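(* $\mathsf{non}(\mathsf{U}_{fin}(\mathcal{B}_\Gamma,\mathcal{B}_\mathrm{T}))=\mathsf{non}(\mathsf{U}_{fin}(\Gamma,\mathrm{T}))=\mathfrak{x}$.
   Context: All spaces $X$ are infinite sets of reals; all covers considered are assumed not to contain $X$ as a member. A cover is a $\gamma$-cover of $X$ if it is infinite and each point lies in all but finitely many members; large if each point lies in infinitely many members. A large cover $\mathcal{U}$ is a $\tau$-cover if for all $x,y\in X$, either ($x\in U\Rightarrow y\in U$) for all but finitely many $U\in\mathcal{U}$, or ($y\in U\Rightarrow x\in U$) for all but finitely many $U\in\mathcal{U}$. $\Gamma,\mathrm{T}$ are the collections of countable open $\gamma$-, $\tau$-covers; $\mathcal{B}_\Gamma,\mathcal{B}_\mathrm{T}$ their countable Borel analogues. $X$ satisfies $\mathsf{U}_{fin}(\mathfrak{U},\mathfrak{V})$ if for every sequence $(\mathcal{U}_n)$ of members of $\mathfrak{U}$ none of which contains a finite subcover, there are finite (possibly empty) $\mathcal{F}_n\subseteq\mathcal{U}_n$ with $\{\bigcup\mathcal{F}_n:n\in\mathbb{N}\}\in\mathfrak{V}$. For a class $\mathcal{J}$ of sets of reals, $\mathsf{non}(\mathcal{J})$ is the minimal cardinality of a set of reals not in $\mathcal{J}$. $f\le^*g$ means $f(n)\le g(n)$ for all but finitely many $n$. A family $Y\subseteq\mathbb{N}^\mathbb{N}$ satisfies the excluded middle property if there is $g\in\mathbb{N}^\mathbb{N}$ such that (i) $g\not\le^*f$ for all $f\in Y$, and (ii) for all $f,h\in Y$,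 at least one of "$f(n)<g(n)\le h(n)$" and "$h(n)<g(n)\le f(n)$" occurs for only finitely many $n$. $\mathfrak{x}$ is the minimal cardinality of a family $Y\subseteq\mathbb{N}^\mathbb{N}$ not satisfying the excluded middle property. *)

theory Defs
  imports "HOL-Analysis.Analysis"
begin

unbundle cardinal_syntax

section \<open>Covers of a space\<close>

text \<open>A cover of the space \<open>X\<close> consists of subsets of \<open>X\<close> and, by convention, never
  has \<open>X\<close> itself as a member.\<close>

definition cover_of :: "'a set \<Rightarrow> 'a set set \<Rightarrow> bool" where
  "cover_of X \<U> \<longleftrightarrow> \<U> \<subseteq> Pow X \<and> \<Union>\<U> = X \<and> X \<notin> \<U>"

definition gamma_cover :: "'a set \<Rightarrow> 'a set set \<Rightarrow> bool" where
  "gamma_cover X \<U> \<longleftrightarrow>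
     cover_of X \<U> \<and> infinite \<U> \<and> (\<forall>x\<in>X. finite {U \<in> \<U>. x \<notin> U})"

definition large_cover :: "'a set \<Rightarrow> 'a set set \<Rightarrow> bool" where
  "large_cover X \<U> \<longleftrightarrow> cover_of X \<U> \<and> (\<forall>x\<in>X. infinite {U \<in> \<U>. x \<in> U})"

definition tau_cover :: "'a set \<Rightarrow> 'a set set \<Rightarrow> bool" where
  "tau_cover X \<U> \<longleftrightarrow> large_cover X \<U> \<and>
     (\<forall>x\<in>X. \<forall>y\<in>X. finite {U \<in> \<U>. \<not> (x \<in> U \<longrightarrow> y \<in> U)} \<or>
                  finite {U \<in> \<U>. \<not> (y \<in> U \<longrightarrow> x \<in> U)})"

text \<open>Open and Borel are meant relative to the subspace \<open>X\<close>.\<close>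

definition open_in_space :: "real set \<Rightarrow> real set set" where
  "open_in_space X = {U. openin (top_of_set X) U}"

definition borel_in_space :: "real set \<Rightarrow> real set set" where
  "borel_in_space X = sets (restrict_space borel X)"

definition Gamma_open :: "real set \<Rightarrow> real set set set" where
  "Gamma_open X = {\<U>. countable \<U> \<and> \<U> \<subseteq> open_in_space X \<and> gamma_cover X \<U>}"

definition Tau_open :: "real set \<Rightarrow> real set set set" where
  "Tau_open X = {\<U>. countable \<U> \<and> \<U> \<subseteq> open_in_space X \<and> tau_cover X \<U>}"

definition Gamma_borel :: "real set \<Rightarrow> real set set set" where
  "Gamma_borel X = {\<U>. countable \<U> \<and> \<U> \<subseteq> borel_in_space X \<and> gamma_cover X \<U>}"

definition Tau_borel :: "real set \<Rightarrow> real set set set" where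
  "Tau_borel X = {\<U>. countable \<U> \<and> \<U> \<subseteq> borel_in_space X \<and> tau_cover X \<U>}"


section \<open>The selection property\<close>

definition has_finite_subcover :: "'a set \<Rightarrow> 'a set set \<Rightarrow> bool" where
  "has_finite_subcover X \<U> \<longleftrightarrow> (\<exists>\<F>. finite \<F> \<and> \<F> \<subseteq> \<U> \<and> \<Union>\<F> = X)"

text \<open>The collection of selected unions is a set of sets, not an indexed family, so
  repeated unions count only once.\<close>

definition U_fin ::
  "('a set \<Rightarrow> 'a set set set) \<Rightarrow> ('a set \<Rightarrow> 'a set set set) \<Rightarrow> 'a set set" where
  "U_fin \<AA> \<BB> = {X. \<forall>\<U> :: nat \<Rightarrow> 'a set set.
     (\<forall>n. \<U> n \<in> \<AA> X \<and> \<not> has_finite_subcover X (\<U> n)) \<longrightarrow>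
     (\<exists>\<F> :: nat \<Rightarrow> 'a set set.
        (\<forall>n. finite (\<F> n) \<and> \<F> n \<subseteq> \<U> n) \<and> range (\<lambda>n. \<Union>(\<F> n)) \<in> \<BB> X)}"


section \<open>Minimal cardinalities\<close>

text \<open>The least cardinality of a member of \<open>\<C>\<close>, as a cardinal order determined up to
  order isomorphism \<open>=o\<close>.  The empty collection gets the cardinal zero.\<close>

definition min_card :: "'a set set \<Rightarrow> 'a rel" where
  "min_card \<C> = (if \<C> = {} then {}
     else (SOME r. \<exists>A\<in>\<C>. r = |A| \<and> (\<forall>B\<in>\<C>. |A| \<le>o |B| )))"

lemma min_card_attained:
  assumes "\<C> \<noteq> {}"
  shows "\<exists>A\<in>\<C>. min_card \<C> = |A| \<and> (\<forall>B\<in>\<C>. |A| \<le>o |B| )"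
proof -
  have "\<exists>r\<in>card_of ` \<C>. \<forall>s\<in>card_of ` \<C>. r \<le>o s"
    using assms by (intro exists_minim_Card_order) (auto intro: card_of_Card_order)
  then have "\<exists>r. \<exists>A\<in>\<C>. r = |A| \<and> (\<forall>B\<in>\<C>. |A| \<le>o |B| )"
    by auto
  from someI_ex[OF this] show ?thesis
    using assms by (simp add: min_card_def)
qed

text \<open>Spaces are infinite sets of reals, so only infinite sets compete for the minimum.\<close>

definition non :: "real set set \<Rightarrow> real rel" where
  "non \<J> = min_card {X. infinite X \<and> X \<notin> \<J>}"


section \<open>The excluded middle property\<close>

definition le_star :: "(nat \<Rightarrow> nat) \<Rightarrow> (nat \<Rightarrow> nat) \<Rightarrow> bool" (infix \<open>\<le>\<^sup>*\<close> 50) where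
  "f \<le>\<^sup>* g \<longleftrightarrow> finite {n. \<not> f n \<le> g n}"

definition excluded_middle_property :: "(nat \<Rightarrow> nat) set \<Rightarrow> bool" where
  "excluded_middle_property Y \<longleftrightarrow> (\<exists>g. (\<forall>f\<in>Y. \<not> g \<le>\<^sup>* f) \<and>
     (\<forall>f\<in>Y. \<forall>h\<in>Y. finite {n. f n < g n \<and> g n \<le> h n} \<or>
                   finite {n. h n < g n \<and> g n \<le> f n}))"

definition cardinal_x :: "(nat \<Rightarrow> nat) rel" where
  "cardinal_x = min_card {Y. \<not> excluded_middle_property Y}"

text \<open>The two facts below show that \<open>cardinal_x\<close> is attained and nonzero.  Hence an equation
  \<open>non \<J> =o cardinal_x\<close> also asserts that some infinite set of reals lies outside \<open>\<J>\<close>.\<close>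

lemma not_excluded_middle_property_UNIV: "\<not> excluded_middle_property UNIV"
proof
  assume "excluded_middle_property UNIV"
  then obtain g where "\<And>f. \<not> g \<le>\<^sup>* f"
    by (auto simp: excluded_middle_property_def)
  from this[of g] show False
    by (simp add: le_star_def)
qed

lemma excluded_middle_property_empty: "excluded_middle_property {}"
  by (simp add: excluded_middle_property_def)

end

theory Submission
  imports Defs
begin

text \<open>Enumerate the \<open>n\<close>-th cover as \<open>(U\<^sub>n\<^sub>,\<^sub>m)\<^sub>m\<close> and send \<open>x\<close> to the function
  \<open>f\<^sub>x n = min {m. x \<in> U\<^sub>n\<^sub>,\<^sub>m}\<close>.  Then \<open>x\<close> lies in \<open>\<Union>\<^sub>m\<^sub><\<^sub>g\<^sub>(\<^sub>n\<^sub>) U\<^sub>n\<^sub>,\<^sub>m\<close> iff \<open>f\<^sub>x n < g n\<close>, so a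
  function \<open>g\<close> witnessing the excluded middle property for the \<open>f\<^sub>x\<close> yields a \<open>\<tau>\<close>-cover.
  Conversely a family \<open>Y\<close> without the property is embedded in the reals together with
  countably many functions, and there the covers \<open>{f. f n < m}\<close>, \<open>m \<in> \<nat>\<close>, are open
  \<open>\<gamma>\<close>-covers from which no \<open>\<tau>\<close>-cover can be selected.\<close>

section \<open>Minimal cardinalities, and tau-covers given by sequences\<close>

lemma min_card_mono:
  assumes "\<C> \<noteq> {}" and "\<And>A. A \<in> \<C> \<Longrightarrow> \<exists>B\<in>\<D>. |B| \<le>o |A|"
  shows "min_card \<D> \<le>o min_card \<C>"
proof -
  obtain A where A: "A \<in> \<C>" "min_card \<C> = |A|"
    using min_card_attained[OF assms(1)] by blast
  with assms(2) obtain B where B: "B \<in> \<D>" "|B| \<le>o |A|"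
    by blast
  with min_card_attained[of \<D>] obtain C where "min_card \<D> = |C|" "|C| \<le>o |B|"
    by blast
  with A B show ?thesis
    using ordLeq_transitive by metis
qed

text \<open>The members of \<open>range V\<close> are counted without repetition, so largeness is not immediate
  from the first assumption.  If only finitely many distinct \<open>V n\<close> contained \<open>x\<close>, those
  occurring infinitely often would form a chain, whose largest element misses some \<open>y\<close>;
  almost every \<open>V n\<close> containing \<open>y\<close> would contain \<open>x\<close>, a contradiction.\<close>

lemma tau_cover_range:
  fixes V :: "nat \<Rightarrow> 'a set"
  assumes sub: "\<And>n. V n \<subset> X"
    and often: "\<And>x. x \<in> X \<Longrightarrow> infinite {n. x \<in> V n}"
    and compare: "\<And>x y. x \<in> X \<Longrightarrow> y \<in> X \<Longrightarrow>
      finite {n. x \<in> V n \<and> y \<notin> V n} \<or> finite {n. y \<in> V n \<and> x \<notin> V n}"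
  shows "tau_cover X (range V)"
proof -
  have large: "infinite {U \<in> range V. x \<in> U}" if x: "x \<in> X" for x
  proof
    assume fin: "finite {U \<in> range V. x \<in> U}"
    define \<A> where "\<A> = {A. x \<in> A \<and> infinite {n. V n = A}}"
    have \<A>_sub: "\<A> \<subseteq> {U \<in> range V. x \<in> U}"
      by (auto simp: \<A>_def dest!: not_finite_existsD)
    then have fin\<A>: "finite \<A>"
      using fin finite_subset by blast
    \<comment> \<open>Pigeonhole: infinitely many indices map into the finitely many sets of the
      range that contain \<open>x\<close>, so one such set is taken infinitely often and hence
      belongs to \<open>\<A>\<close>.\<close>
    have hit: "\<exists>A\<in>\<A>. infinite {n\<in>N. V n = A}" if N: "infinite N" "\<forall>n\<in>N. x \<in> V n" for N
    proof -
      have "finite (V ` N)"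
        using N(2) by (intro finite_subset[OF _ fin]) auto
      from pigeonhole_infinite[OF N(1) this] obtain k
        where k: "k \<in> N" "infinite {n\<in>N. V n = V k}" by auto
      moreover have "infinite {n. V n = V k}"
        using k(2) by (rule contrapos_nn) (auto elim: finite_subset[rotated])
      ultimately show ?thesis
        using N(2) by (auto simp: \<A>_def)
    qed
    have "\<A> \<noteq> {}"
      using hit[OF often[OF x]] by auto
    \<comment> \<open>Points \<open>a\<close>, \<open>b\<close> telling two incomparable members
      apart would do so at infinitely many indices in both directions, contrary to
      \<open>compare\<close>.\<close>
    have chain: "A \<subseteq> B \<or> B \<subseteq> A" if "A \<in> \<A>" "B \<in> \<A>" for A B
    proof (rule ccontr)
      assume "\<not> (A \<subseteq> B \<or> B \<subseteq> A)"
      then obtain a b where ab: "a \<in> A" "a \<notin> B" "b \<in> B" "b \<notin> A"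
        by blast
      have "a \<in> X" "b \<in> X"
        using ab that \<A>_sub sub by blast+
      moreover have "{n. V n = A} \<subseteq> {n. a \<in> V n \<and> b \<notin> V n}"
          "{n. V n = B} \<subseteq> {n. b \<in> V n \<and> a \<notin> V n}"
        using ab by auto
      ultimately show False
        using compare[of a b] that by (auto simp: \<A>_def dest: finite_subset)
    qed
    obtain M where M: "M \<in> \<A>" "\<And>A. A \<in> \<A> \<Longrightarrow> A \<subseteq> M"
      using finite_has_maximal[OF fin\<A> \<open>\<A> \<noteq> {}\<close>] chain by metis
    have "M \<subset> X"
      using M(1) \<A>_sub sub by blast
    then obtain y where y: "y \<in> X" "y \<notin> M"
      by blast
    have "{n. V n = M} \<subseteq> {n. x \<in> V n \<and> y \<notin> V n}"
      using M(1) y by (auto simp: \<A>_def)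
    moreover have "infinite {n. V n = M}"
      using M(1) by (simp add: \<A>_def)
    ultimately have "finite {n. y \<in> V n \<and> x \<notin> V n}"
      using compare[OF x y(1)] finite_subset by blast
    moreover have "{n. y \<in> V n} = {n. y \<in> V n \<and> x \<in> V n} \<union> {n. y \<in> V n \<and> x \<notin> V n}"
      by auto
    ultimately have "infinite {n. y \<in> V n \<and> x \<in> V n}"
      using often[OF y(1)] by (metis finite_UnI)
    \<comment> \<open>Pigeonhole again, now yielding a member of \<open>\<A>\<close> that contains
      \<open>y\<close>, whereas every member of \<open>\<A>\<close> lies inside
      \<open>M\<close>.\<close>
    from hit[OF this] obtain A where A: "A \<in> \<A>"
        and inf: "infinite {n \<in> {n. y \<in> V n \<and> x \<in> V n}. V n = A}"
      by auto
    from not_finite_existsD[OF inf] have "y \<in> A"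
      by auto
    then show False
      using M(2)[OF A] y(2) by auto
  qed
  have "\<exists>n. x \<in> V n" if "x \<in> X" for x
    using not_finite_existsD[OF often[OF that]] .
  then have "cover_of X (range V)"
    using sub by (fastforce simp: cover_of_def)
  moreover have "finite {U \<in> range V. \<not> (x \<in> U \<longrightarrow> y \<in> U)}"
    if "finite {n. x \<in> V n \<and> y \<notin> V n}" for x y
    by (rule finite_subset[OF _ finite_imageI[OF that, of V]]) auto
  ultimately show ?thesis
    using large compare unfolding tau_cover_def large_cover_def by meson
qed

section \<open>From spaces to families of functions\<close>

lemma no_excluded_middle_of_not_U_fin_borel:
  assumes "X \<notin> U_fin Gamma_borel Tau_borel"
  shows "\<exists>Y. \<not> excluded_middle_property Y \<and> |Y| \<le>o |X|"
proof -
  obtain \<U> :: "nat \<Rightarrow> real set set"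
    where "\<forall>n. \<U> n \<in> Gamma_borel X \<and> \<not> has_finite_subcover X (\<U> n)"
    and bad: "\<nexists>\<F>. (\<forall>n. finite (\<F> n) \<and> \<F> n \<subseteq> \<U> n) \<and> range (\<lambda>n. \<Union>(\<F> n)) \<in> Tau_borel X"
    using assms unfolding U_fin_def mem_Collect_eq not_all not_imp by (elim exE conjE) (rule that)
  then have \<U>: "\<U> n \<in> Gamma_borel X" "\<not> has_finite_subcover X (\<U> n)" for n
    by auto
  define W where "W n = from_nat_into (\<U> n)" for n
  have ne: "\<U> n \<noteq> {}" "countable (\<U> n)" for n
    using \<U>(1)[of n] by (auto simp: Gamma_borel_def gamma_cover_def)
  then have W: "range (W n) = \<U> n" for n
    by (simp add: W_def range_from_nat_into)
  have cover: "\<exists>m. x \<in> W n m" if "x \<in> X" for x n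
  proof -
    have "x \<in> \<Union>(range (W n))"
      using that \<U>(1)[of n] by (auto simp: W Gamma_borel_def gamma_cover_def cover_of_def)
    then show ?thesis by auto
  qed
  define \<Phi> where "\<Phi> x n = (LEAST m. x \<in> W n m)" for x n
  have "\<not> excluded_middle_property (\<Phi> ` X)"
  proof
    assume "excluded_middle_property (\<Phi> ` X)"
    then obtain g where g1: "\<And>x. x \<in> X \<Longrightarrow> \<not> g \<le>\<^sup>* \<Phi> x"
      and g2: "\<And>x y. x \<in> X \<Longrightarrow> y \<in> X \<Longrightarrow> finite {n. \<Phi> x n < g n \<and> g n \<le> \<Phi> y n} \<or>
                   finite {n. \<Phi> y n < g n \<and> g n \<le> \<Phi> x n}"
      by (auto simp: excluded_middle_property_def)
    define \<F> where "\<F> n = W n ` {..<g n}" for n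
    have \<F>: "finite (\<F> n) \<and> \<F> n \<subseteq> \<U> n" for n
      using W by (auto simp: \<F>_def)
    have mem: "x \<in> \<Union>(\<F> n) \<longleftrightarrow> \<Phi> x n < g n" if x: "x \<in> X" for x n
    proof
      assume "x \<in> \<Union>(\<F> n)"
      then obtain m where "m < g n" "x \<in> W n m"
        by (auto simp: \<F>_def)
      then show "\<Phi> x n < g n"
        unfolding \<Phi>_def by (meson Least_le le_less_trans)
    next
      assume "\<Phi> x n < g n"
      moreover have "x \<in> W n (\<Phi> x n)"
        unfolding \<Phi>_def using cover[OF x] by (rule LeastI_ex)
      ultimately show "x \<in> \<Union>(\<F> n)"
        by (auto simp: \<F>_def)
    qed
    have "\<U> n \<subseteq> Pow X" for n
      using \<U>(1)[of n] by (auto simp: Gamma_borel_def gamma_cover_def cover_of_def)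
    \<comment> \<open>The inclusion is proper because \<open>\<U> n\<close> has no finite
      subcover.\<close>
    then have "\<Union>(\<F> n) \<subset> X" for n
      using \<F>[of n] \<U>(2)[of n] unfolding has_finite_subcover_def by blast
    moreover have "infinite {n. x \<in> \<Union>(\<F> n)}" if "x \<in> X" for x
      using g1[OF that] mem[OF that] by (simp add: le_star_def not_le)
    moreover have "finite {n. x \<in> \<Union>(\<F> n) \<and> y \<notin> \<Union>(\<F> n)} \<or>
        finite {n. y \<in> \<Union>(\<F> n) \<and> x \<notin> \<Union>(\<F> n)}" if "x \<in> X" "y \<in> X" for x y
      using g2[OF that] mem[OF that(1)] mem[OF that(2)] by (simp add: not_less)
    ultimately have "tau_cover X (range (\<lambda>n. \<Union>(\<F> n)))"
      by (rule tau_cover_range)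
    moreover have "\<Union>(\<F> n) \<in> borel_in_space X" for n
    proof -
      have "\<F> n \<subseteq> sets (restrict_space borel X)"
        using \<F>[of n] \<U>(1)[of n] by (auto simp: Gamma_borel_def borel_in_space_def)
      then show ?thesis
        unfolding borel_in_space_def using \<F>[of n] by (intro sets.finite_Union) auto
    qed
    ultimately have "range (\<lambda>n. \<Union>(\<F> n)) \<in> Tau_borel X"
      by (auto simp: Tau_borel_def)
    with bad \<F> show False
      by blast
  qed
  then show ?thesis
    using card_of_image by blast
qed

section \<open>Open covers versus Borel covers\<close>

lemma open_in_space_subset_borel_in_space: "open_in_space X \<subseteq> borel_in_space X"
  by (auto simp: open_in_space_def borel_in_space_def sets_restrict_space openin_open)

text \<open>Open covers are Borel covers, so the Borel property supplies a selection; its finite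
  unions of open sets are open again.\<close>

lemma U_fin_borel_subset_U_fin_open:
  "U_fin Gamma_borel Tau_borel \<subseteq> U_fin Gamma_open Tau_open"
proof
  fix X assume X: "X \<in> U_fin Gamma_borel Tau_borel"
  show "X \<in> U_fin Gamma_open Tau_open"
    unfolding U_fin_def
  proof (intro CollectI allI impI)
    fix \<U> :: "nat \<Rightarrow> real set set"
    assume \<U>: "\<forall>n. \<U> n \<in> Gamma_open X \<and> \<not> has_finite_subcover X (\<U> n)"
    then have "\<forall>n. \<U> n \<in> Gamma_borel X \<and> \<not> has_finite_subcover X (\<U> n)"
      using open_in_space_subset_borel_in_space by (auto simp: Gamma_open_def Gamma_borel_def)
    then obtain \<F> where \<F>: "\<forall>n. finite (\<F> n) \<and> \<F> n \<subseteq> \<U> n"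
        and tau: "range (\<lambda>n. \<Union>(\<F> n)) \<in> Tau_borel X"
      using X unfolding U_fin_def by blast
    have "\<Union>(\<F> n) \<in> open_in_space X" for n
      using \<F> \<U> by (fastforce simp: open_in_space_def Gamma_open_def)
    then have "range (\<lambda>n. \<Union>(\<F> n)) \<in> Tau_open X"
      using tau by (auto simp: Tau_open_def Tau_borel_def)
    with \<F> show "\<exists>\<F>. (\<forall>n. finite (\<F> n) \<and> \<F> n \<subseteq> \<U> n) \<and> range (\<lambda>n. \<Union>(\<F> n)) \<in> Tau_open X"
      by blast
  qed
qed

section \<open>An embedding of the Baire space into the real line\<close>

text \<open>With ratio 1/3 all terms after position \<open>j\<close> sum to at most half of the
  weight at \<open>j\<close>, so they cannot cancel the first difference.\<close>

lemma suminf_of_bool_thirds_diff: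
  fixes c d :: "nat \<Rightarrow> bool"
  assumes "c j \<noteq> d j" and agree: "\<And>i. i < j \<Longrightarrow> c i = d i"
  shows "(1/3) ^ j / 2 \<le> \<bar>(\<Sum>k. of_bool (c k) * (1/3) ^ k) - (\<Sum>k. of_bool (d k) * (1/3::real) ^ k)\<bar>"
proof -
  have geo: "summable (\<lambda>k. (1/3::real) ^ k)"
    by (simp add: summable_geometric)
  have summ: "summable (\<lambda>k. of_bool (c k) * (1/3::real) ^ k)" for c :: "nat \<Rightarrow> bool"
    by (rule summable_comparison_test'[OF geo, of 0]) auto
  define t where "t k = (of_bool (c k) - of_bool (d k)) * (1/3::real) ^ k" for k
  have t_le: "\<bar>t k\<bar> \<le> (1/3) ^ k" for k
    by (auto simp: t_def)
  have sum_t: "summable t"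
    by (rule summable_comparison_test'[OF geo, of 0]) (use t_le in auto)
  have t0: "(\<Sum>k<j. t k) = 0"
    by (rule sum.neutral) (auto simp: t_def agree)
  have "(\<Sum>k. of_bool (c k) * (1/3) ^ k) - (\<Sum>k. of_bool (d k) * (1/3::real) ^ k) = suminf t"
    unfolding suminf_diff[OF summ summ] t_def left_diff_distrib ..
  \<comment> \<open>The terms before \<open>j\<close> vanish, which leaves the term at
    \<open>j\<close> and the tail.\<close>
  also have "\<dots> = (\<Sum>k. t (k + Suc j)) + t j"
    using suminf_split_initial_segment[OF sum_t, of "Suc j"] t0 by simp
  finally have eq: "(\<Sum>k. of_bool (c k) * (1/3) ^ k) - (\<Sum>k. of_bool (d k) * (1/3::real) ^ k)
      = (\<Sum>k. t (k + Suc j)) + t j" .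
  have geo': "(\<lambda>k. (1/3::real) ^ (k + Suc j)) sums ((1/3) ^ j / 2)"
    using sums_mult2[OF geometric_sums[of "1/3::real"], of "(1/3) ^ Suc j"]
    by (simp add: power_add)
  have "norm (\<Sum>k. t (k + Suc j)) \<le> (\<Sum>k. (1/3::real) ^ (k + Suc j))"
    by (rule norm_suminf_le) (use t_le[of "_ + Suc j"] sums_summable[OF geo'] in \<open>simp_all only: real_norm_def\<close>)
  then have "\<bar>\<Sum>k. t (k + Suc j)\<bar> \<le> (1/3) ^ j / 2"
    using sums_unique[OF geo'] by simp
  moreover have "\<bar>t j\<bar> = (1/3) ^ j"
    using assms(1) by (auto simp: t_def)
  ultimately show ?thesis
    unfolding eq by linarith
qed

text \<open>The graph of \<open>f\<close> is coded as a sequence of digits 0 and 1 weighted by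
  powers of 1/3. Images close to \<open>\<phi> f\<close> share its digit for the pair
  \<open>(n, f n)\<close>, which fixes the value at \<open>n\<close>. This local constancy later
  gives both injectivity of \<open>\<phi>\<close> and openness of the covers.\<close>

lemma baire_space_embedding_real:
  obtains \<phi> :: "(nat \<Rightarrow> nat) \<Rightarrow> real"
  where "\<And>f n. \<exists>e>0. \<forall>h. dist (\<phi> h) (\<phi> f) < e \<longrightarrow> h n = f n"
proof -
  define c where "c f k \<longleftrightarrow> f (fst (prod_decode k)) = snd (prod_decode k)"
    for f :: "nat \<Rightarrow> nat" and k
  define \<phi> where "\<phi> f = (\<Sum>k. of_bool (c f k) * (1/3::real) ^ k)" for f
  have "\<exists>e>0. \<forall>h. dist (\<phi> h) (\<phi> f) < e \<longrightarrow> h n = f n" for f n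
  proof (intro exI conjI allI impI)
    define k where "k = prod_encode (n, f n)"
    show "(1/3::real) ^ k / 2 > 0"
      by simp
    fix h assume close: "dist (\<phi> h) (\<phi> f) < (1/3) ^ k / 2"
    show "h n = f n"
    proof (rule ccontr)
      assume "h n \<noteq> f n"
      then have k: "c h k \<noteq> c f k"
        by (simp add: c_def k_def)
      \<comment> \<open>The gap estimate applies at the first difference \<open>j\<close>, and the
        gap at \<open>j\<close> is at least the one at \<open>k\<close>.\<close>
      define j where "j = (LEAST i. c h i \<noteq> c f i)"
      have "c h j \<noteq> c f j" "j \<le> k" and "\<And>i. i < j \<Longrightarrow> c h i = c f i"
        unfolding j_def using k by (rule LeastI, rule Least_le) (auto dest: not_less_Least)
      then have "(1/3) ^ j / 2 \<le> dist (\<phi> h) (\<phi> f)"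
        unfolding \<phi>_def dist_real_def by (intro suminf_of_bool_thirds_diff)
      moreover have "(1/3::real) ^ k \<le> (1/3) ^ j"
        using \<open>j \<le> k\<close> by (intro power_decreasing) auto
      ultimately show False
        using close by simp
    qed
  qed
  then show ?thesis
    by (rule that)
qed

section \<open>From families of functions to spaces\<close>

text \<open>A function strictly above all members everywhere is a witness. Hence a family without
  the property is infinite, which makes the space built from it infinite and lets it absorb
  countably many extra functions.\<close>

lemma excluded_middle_property_finite:
  assumes "finite Y"
  shows "excluded_middle_property Y"
proof -
  define g where "g n = Suc (\<Sum>f\<in>Y. f n)" for n
  have "f n < g n" if "f \<in> Y" for f n
    using member_le_sum[of f Y "\<lambda>f. f n"] assms that by (simp add: g_def less_Suc_eq_le)
  then have "\<forall>f\<in>Y. \<forall>n. f n < g n"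
    by blast
  then show ?thesis
    unfolding excluded_middle_property_def le_star_def
    by (intro exI[of _ g]) (auto simp: not_le[symmetric])
qed

lemma excluded_middle_property_mono:
  "excluded_middle_property Y \<Longrightarrow> Z \<subseteq> Y \<Longrightarrow> excluded_middle_property Z"
  unfolding excluded_middle_property_def by (meson subsetD)

lemma not_U_fin_open_of_no_excluded_middle:
  assumes Y: "\<not> excluded_middle_property Y"
  shows "\<exists>X. infinite X \<and> X \<notin> U_fin Gamma_open Tau_open \<and> |X| \<le>o |Y|"
proof -
  obtain \<phi> :: "(nat \<Rightarrow> nat) \<Rightarrow> real"
    where \<phi>: "\<And>f n. \<exists>e>0. \<forall>h. dist (\<phi> h) (\<phi> f) < e \<longrightarrow> h n = f n"
    using baire_space_embedding_real by blast
  have "inj \<phi>"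
  proof (intro injI ext)
    fix f h n assume "\<phi> f = \<phi> h"
    then show "f n = h n"
      using \<phi>[of h n] by auto
  qed
  then have \<phi>_iff: "\<phi> f = \<phi> h \<longleftrightarrow> f = h" for f h
    by (simp add: inj_eq)
  \<comment> \<open>\<open>z n m\<close> has value \<open>m\<close> at \<open>n\<close> and 0
    elsewhere. Adding these functions ensures that \<open>D n m\<close> is never all of
    \<open>X\<close> and that \<open>D n\<close> is injective, so that each cover is
    infinite.\<close>
  define z where "z n m = (\<lambda>_. 0)(n := m)" for n m :: nat
  define Y' where "Y' = Y \<union> range (case_prod z)"
  define X where "X = \<phi> ` Y'"
  define D where "D n m = \<phi> ` {f \<in> Y'. f n < m}" for n m
  have z: "z n m \<in> Y'" for n m
    by (auto simp: Y'_def)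
  have mem_D: "\<phi> f \<in> D n m \<longleftrightarrow> f \<in> Y' \<and> f n < m" for f n m
    by (auto simp: D_def \<phi>_iff)
  have "infinite Y"
    using Y excluded_middle_property_finite by blast
  have "infinite X"
    using \<open>infinite Y\<close> \<open>inj \<phi>\<close> by (simp add: X_def Y'_def finite_image_iff inj_on_subset)
  have "|range (case_prod z)| \<le>o |Y|"
    using card_of_image[of "case_prod z" UNIV] card_of_ordLeqI[of prod_encode UNIV UNIV]
      \<open>infinite Y\<close>[unfolded infinite_iff_card_of_nat] inj_prod_encode
    by (meson UNIV_I ordLeq_transitive)
  then have "|Y'| \<le>o |Y|"
    unfolding Y'_def using \<open>infinite Y\<close>
    by (intro card_of_Un_ordLeq_infinite_Field) (auto simp: Field_card_of card_of_card_order_on intro: ordLeq_refl)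
  then have "|X| \<le>o |Y|"
    unfolding X_def using card_of_image ordLeq_transitive by blast
  have D_ne: "D n m \<noteq> X" for n m
  proof -
    have "\<phi> (z n m) \<notin> D n m" "\<phi> (z n m) \<in> X"
      using z by (auto simp: mem_D X_def z_def)
    then show ?thesis by blast
  qed
  \<comment> \<open>The sets \<open>D n m\<close> increase with \<open>m\<close>, so a finite union
    of them is the largest one; the empty selection corresponds to \<open>m = 0\<close>.\<close>
  have D_Union: "\<exists>m. \<Union>\<F> = D n m" if "finite \<F>" "\<F> \<subseteq> range (D n)" for \<F> n
    using that
  proof (induction \<F>)
    case empty
    then show ?case by (auto simp: D_def intro!: exI[of _ 0])
  next
    case (insert A \<F>)
    then obtain a b where "A = D n a" "\<Union>\<F> = D n b"
      by auto
    then have "\<Union>(insert A \<F>) = D n (max a b)"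
      by (auto simp: D_def less_max_iff_disj)
    then show ?case by blast
  qed
  have "inj (D n)" for n
  proof (rule linorder_injI)
    fix a b :: nat assume "a < b"
    then have "\<phi> (z n a) \<in> D n b" "\<phi> (z n a) \<notin> D n a"
      using z by (auto simp: mem_D z_def)
    then show "D n a \<noteq> D n b" by blast
  qed
  moreover have "D n m \<in> open_in_space X" for n m
  proof -
    have "\<exists>e>0. \<forall>x'\<in>X. dist x' x < e \<longrightarrow> x' \<in> D n m" if x: "x \<in> D n m" for x
    proof -
      obtain f where f: "x = \<phi> f" "f n < m"
        using x by (auto simp: D_def)
      obtain e where "e > 0" "\<forall>h. dist (\<phi> h) (\<phi> f) < e \<longrightarrow> h n = f n"
        using \<phi> by blast
      then show ?thesis
        using f by (intro exI[of _ e]) (auto simp: X_def mem_D)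
    qed
    moreover have "D n m \<subseteq> X"
      by (auto simp: D_def X_def)
    ultimately show ?thesis
      by (auto simp: open_in_space_def openin_euclidean_subtopology_iff)
  qed
  moreover have "cover_of X (range (D n))" for n
    using D_ne by (auto simp: cover_of_def) (auto simp: D_def X_def)
  moreover have "finite {U \<in> range (D n). x \<notin> U}" if x: "x \<in> X" for x n
  proof -
    obtain f where "f \<in> Y'" "x = \<phi> f"
      using x by (auto simp: X_def)
    then have "{U \<in> range (D n). x \<notin> U} \<subseteq> D n ` {..f n}"
      by (auto simp: mem_D)
    then show ?thesis
      by (rule finite_subset) simp
  qed
  ultimately have Gamma: "range (D n) \<in> Gamma_open X" for n
    by (auto simp: Gamma_open_def gamma_cover_def finite_image_iff)
  have no_sub: "\<not> has_finite_subcover X (range (D n))" for n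
    unfolding has_finite_subcover_def using D_Union[of _ n] D_ne[of n] by metis
  have "X \<notin> U_fin Gamma_open Tau_open"
  proof
    assume "X \<in> U_fin Gamma_open Tau_open"
    then obtain \<F> where \<F>: "\<forall>n. finite (\<F> n) \<and> \<F> n \<subseteq> range (D n)"
      and Tau: "range (\<lambda>n. \<Union>(\<F> n)) \<in> Tau_open X"
      using Gamma no_sub unfolding U_fin_def mem_Collect_eq
      by (elim allE[of _ "\<lambda>n. range (D n)"] impE) auto
    have "\<exists>m. \<Union>(\<F> n) = D n m" for n
      using \<F> by (intro D_Union) auto
    then obtain g where g: "\<Union>(\<F> n) = D n (g n)" for n
      by metis
    define V where "V n = D n (g n)" for n
    have tau: "tau_cover X (range V)"
      using Tau by (simp add: Tau_open_def g V_def[symmetric])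
    have mem_V: "\<phi> f \<in> V n \<longleftrightarrow> f n < g n" if "f \<in> Y'" for f n
      using that by (simp add: V_def mem_D)
    \<comment> \<open>The functions \<open>z n m\<close> separate distinct nonempty \<open>V n\<close>, so that counting sets
      amounts to counting indices.\<close>
    have inj: "inj_on V {n. V n \<noteq> {}}"
    proof (rule linorder_inj_onI')
      fix n m :: nat assume "n \<in> {n. V n \<noteq> {}}" "m \<in> {n. V n \<noteq> {}}" "n < m"
      then have "\<phi> (z m (g m)) \<in> V n" "\<phi> (z m (g m)) \<notin> V m"
        using z by (auto simp: mem_V) (auto simp: z_def V_def D_def)
      then show "V n \<noteq> V m" by blast
    qed
    have "\<not> g \<le>\<^sup>* f" if f: "f \<in> Y'" for f
    proof -
      \<comment> \<open>Infinitely many sets require infinitely many indices, so this half holds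
        even if sets repeat.\<close>
      have "infinite {U \<in> range V. \<phi> f \<in> U}"
        using tau f by (auto simp: tau_cover_def large_cover_def X_def)
      moreover have "{U \<in> range V. \<phi> f \<in> U} = V ` {n. \<not> g n \<le> f n}"
        using mem_V[OF f] by (auto simp: not_le)
      ultimately show ?thesis
        by (auto simp: le_star_def)
    qed
    moreover have "finite {n. f n < g n \<and> g n \<le> h n}"
      if fh: "f \<in> Y'" "h \<in> Y'" and fin: "finite {U \<in> range V. \<not> (\<phi> f \<in> U \<longrightarrow> \<phi> h \<in> U)}" for f h
    proof -
      let ?N = "{n. f n < g n \<and> g n \<le> h n}"
      have "V ` ?N \<subseteq> {U \<in> range V. \<not> (\<phi> f \<in> U \<longrightarrow> \<phi> h \<in> U)}"
        using mem_V fh by (auto simp: not_less)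
      \<comment> \<open>For \<open>n\<close> in \<open>?N\<close> the set \<open>V n\<close>
        contains \<open>\<phi> f\<close> and is therefore nonempty, so \<open>inj\<close> applies
        and finitely many sets come from finitely many indices.\<close>
      moreover have "inj_on V ?N"
        by (rule inj_on_subset[OF inj]) (use mem_V[OF fh(1)] in auto)
      ultimately show ?thesis
        using fin by (meson finite_imageD finite_subset)
    qed
    moreover have "finite {U \<in> range V. \<not> (\<phi> f \<in> U \<longrightarrow> \<phi> h \<in> U)} \<or>
        finite {U \<in> range V. \<not> (\<phi> h \<in> U \<longrightarrow> \<phi> f \<in> U)}" if "f \<in> Y'" "h \<in> Y'" for f h
      using tau that by (simp add: tau_cover_def X_def)
    ultimately have "excluded_middle_property Y'"
      unfolding excluded_middle_property_def by meson
    then show False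
      using Y excluded_middle_property_mono by (auto simp: Y'_def)
  qed
  with \<open>infinite X\<close> \<open>|X| \<le>o |Y|\<close> show ?thesis
    by blast
qed

section \<open>The cycle of inequalities\<close>

theorem theorem4p4:
  shows "non (U_fin Gamma_borel Tau_borel) =o non (U_fin Gamma_open Tau_open)
       \<and> non (U_fin Gamma_open Tau_open) =o cardinal_x"
proof -
  let ?B = "{X. infinite X \<and> X \<notin> U_fin Gamma_borel Tau_borel}"
  let ?O = "{X. infinite X \<and> X \<notin> U_fin Gamma_open Tau_open}"
  let ?E = "{Y. \<not> excluded_middle_property Y}"
  have sub: "?O \<subseteq> ?B"
    using U_fin_borel_subset_U_fin_open by blast
  \<comment> \<open>\<open>min_card\<close> is zero on the empty collection, so the collection on
    the larger side of each comparison has to be shown nonempty.\<close>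
  have "?E \<noteq> {}"
    using not_excluded_middle_property_UNIV by blast
  then have "?O \<noteq> {}"
    using not_U_fin_open_of_no_excluded_middle by blast
  have OE: "min_card ?O \<le>o min_card ?E"
    using \<open>?E \<noteq> {}\<close> not_U_fin_open_of_no_excluded_middle by (intro min_card_mono) auto
  have BO: "min_card ?B \<le>o min_card ?O"
    using \<open>?O \<noteq> {}\<close> sub card_of_mono1[OF order_refl] by (intro min_card_mono) blast+
  have EB: "min_card ?E \<le>o min_card ?B"
    using \<open>?O \<noteq> {}\<close> sub no_excluded_middle_of_not_U_fin_borel
    by (intro min_card_mono) auto
  show ?thesis
    \<comment> \<open>The inequalities \<open>OE\<close>, \<open>EB\<close> and \<open>BO\<close>
      form a cycle, so all three cardinals agree.\<close>
    unfolding non_def cardinal_x_def ordIso_iff_ordLeq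
    using OE BO EB ordLeq_transitive[OF OE EB] ordLeq_transitive[OF EB BO] by (intro conjI)
qed

end
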